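(* If $\phi$ is an even isometry of $\mathcal{C}_n$, then there exist two permutations $\pi$ and $\sigma$ of $\{1,\ldots,n\}$, and two words $\overline{a},\overline{b}\in\mathcal{C}_n$, both of even weight or both of odd weight, such that $$\phi=\begin{cases} T_{\overline{a}}\circ\pi & \text{on } E,\\ T_{\overline{b}}\circ\sigma & \text{on } O.\end{cases}$$ Conversely, for any two permutations $\pi,\sigma$ and any two words $\overline{a},\overline{b}$ both of even weight or both of odd weight, the map defined in this way is an even isometry.
   Context: $\mathcal{C}_n=\{0,1\}^n$ is the Boolean cube with Hamming distance $d$ and component-wise addition modulo $2$. The weight of a word is its number of non-zero positions; $E$ and $O$ are the sets of words of even weight and odd weight in $\mathcal{C}_n$, respectively. A permutation $\pi$ of $\{1,\ldots,n\}$ is identified with the map it induces on $\mathcal{C}_n$, $\pi(x_1,\ldots,x_n)=(x_{\pi(1)},\ldots,x_{\pi(n)})$. $T_{\overline{a}}$ is the translation $\overline{c}\mapsto\overline{c}+\overline{a}$. An even isometry is a bijection $\phi$ of $\mathcal{C}_n$ such that, for every even $p\in\{1,\ldots,n\}$, $d(\phi(x),\phi(y))=p$ whenever $d(x,y)=p$.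
   Formalization: The first claim is proved for n ≠ 4 only: for n = 4 it is false, since swapping 0000 and 1111 and fixing all other words is an even isometry not of the form T_a∘π on E; the converse is proved for every n. *)

theory Defs
  imports "HOL-Analysis.Finite_Cartesian_Product" "HOL-Library.Z2"
    "HOL-Combinatorics.Permutations"
begin

text \<open>
  The Boolean cube of dimension n is the type \<open>bit ^ 'n\<close> with n = \<open>CARD('n)\<close>: the finite
  index type stands for \<open>{1..n}\<close>, and \<open>+\<close> on vectors over the two-element field \<open>bit\<close> is
  component-wise addition modulo 2.
\<close>

definition weight :: "bit ^ 'n::finite \<Rightarrow> nat" where
  "weight x = card {i. x $ i \<noteq> 0}"

definition hamming_dist :: "bit ^ 'n::finite \<Rightarrow> bit ^ 'n \<Rightarrow> nat" where
  "hamming_dist x y = card {i. x $ i \<noteq> y $ i}"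

definition even_words :: "(bit ^ 'n::finite) set" where
  "even_words = {x. even (weight x)}"

definition odd_words :: "(bit ^ 'n::finite) set" where
  "odd_words = {x. odd (weight x)}"

definition permute_word :: "('n::finite \<Rightarrow> 'n) \<Rightarrow> bit ^ 'n \<Rightarrow> bit ^ 'n" where
  "permute_word \<pi> x = (\<chi> i. x $ \<pi> i)"

definition translation :: "bit ^ 'n::finite \<Rightarrow> bit ^ 'n \<Rightarrow> bit ^ 'n" where
  "translation a c = c + a"

definition even_isometry :: "(bit ^ 'n::finite \<Rightarrow> bit ^ 'n) \<Rightarrow> bool" where
  "even_isometry \<phi> \<longleftrightarrow>
     bij \<phi> \<and>
     (\<forall>p\<in>{1..CARD('n)}. even p \<longrightarrow>
        (\<forall>x y. hamming_dist x y = p \<longrightarrow> hamming_dist (\<phi> x) (\<phi> y) = p))"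

text \<open>
  The classification of even isometries needs n to be different from 4. In dimension 4, exchanging
  the zero word with the all-one word and fixing all other words is an even isometry, but it does
  not agree on the even words with any permutation followed by a translation.
\<close>

lemma dim_4_exception:
  assumes n4: "CARD('n::finite) = 4"
  shows "\<exists>\<phi> :: bit ^ 'n \<Rightarrow> bit ^ 'n. even_isometry \<phi> \<and>
    \<not> (\<exists>\<pi> a. \<pi> permutes UNIV \<and>
          (\<forall>x\<in>even_words. \<phi> x = (translation a \<circ> permute_word \<pi>) x))"
proof -
  define u :: "bit ^ 'n" where "u = (\<chi> i. 1)"
  define \<phi> :: "bit ^ 'n \<Rightarrow> bit ^ 'n"
    where "\<phi> x = (if x = 0 then u else if x = u then 0 else x)" for x
  have un0: "u \<noteq> 0" by (simp add: u_def vec_eq_iff)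
  have invol: "\<phi> (\<phi> x) = x" for x using un0 by (auto simp: \<phi>_def)
  have comm: "hamming_dist x y = hamming_dist y x" for x y :: "bit ^ 'n"
    unfolding hamming_dist_def by (rule arg_cong[of _ _ card]) auto
  have compl: "hamming_dist u y + hamming_dist 0 y = 4" for y
  proof -
    have "{i. 0 \<noteq> y $ i} = - {i. u $ i \<noteq> y $ i}" by (auto simp: u_def)
    then have "hamming_dist 0 y = CARD('n) - hamming_dist u y"
      unfolding hamming_dist_def by (simp add: Compl_eq_Diff_UNIV card_Diff_subset)
    moreover have "hamming_dist u y \<le> CARD('n)"
      unfolding hamming_dist_def by (rule card_mono) auto
    ultimately show ?thesis using n4 by simp
  qed
  have full: "y = u" if "hamming_dist u y = 0" for y
    using that unfolding hamming_dist_def by (auto simp: vec_eq_iff)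
  have null: "y = 0" if "hamming_dist 0 y = 0" for y :: "bit ^ 'n"
    using that unfolding hamming_dist_def by (auto simp: vec_eq_iff)
  have self: "hamming_dist y y = 0" for y :: "bit ^ 'n" by (simp add: hamming_dist_def)
  have swap: "hamming_dist u y = p \<and> hamming_dist 0 y = p"
    if "p \<in> {1..4}" "even p" "y \<noteq> 0" "y \<noteq> u" "hamming_dist 0 y = p \<or> hamming_dist u y = p" for p y
  proof -
    have "p \<noteq> 4" using that compl[of y] full[of y] null[of y] by auto
    then have "p = 2" using that(1,2) by (cases "p = 1 \<or> p = 3") auto
    then show ?thesis using that(5) compl[of y] by auto
  qed
  have dist: "hamming_dist (\<phi> x) (\<phi> y) = p"
    if p: "p \<in> {1..4}" "even p" and d: "hamming_dist x y = p" for p x y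
  proof -
    consider "{x, y} \<subseteq> {0, u}" | "x \<in> {0, u}" "y \<notin> {0, u}" | "x \<notin> {0, u}" "y \<in> {0, u}"
      | "x \<notin> {0, u}" "y \<notin> {0, u}" by blast
    then show ?thesis
    proof cases
      case 1
      then show ?thesis using d un0 self[of 0] self[of u] comm[of u 0] by (auto simp: \<phi>_def)
    next
      case 2
      then have "hamming_dist u y = p \<and> hamming_dist 0 y = p"
        using d by (intro swap[OF p]) blast+
      then show ?thesis using 2 un0 unfolding \<phi>_def by auto
    next
      case 3
      then have "hamming_dist u x = p \<and> hamming_dist 0 x = p"
        using d comm[of x y] by (intro swap[OF p]) auto
      then show ?thesis using 3 un0 unfolding \<phi>_def comm[of x 0] comm[of x u]
        by (auto simp: comm[of x 0] comm[of x u])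
    next
      case 4
      then show ?thesis using d by (simp add: \<phi>_def)
    qed
  qed
  have iso: "even_isometry \<phi>"
    unfolding even_isometry_def n4 
    using dist o_bij[of \<phi> \<phi>] invol by (simp add: fun_eq_iff)
  have "False"
    if eq: "\<And>x. x \<in> even_words \<Longrightarrow> \<phi> x = (translation a \<circ> permute_word \<pi>) x" for \<pi> a
  proof -
    have "\<phi> 0 = a"
      using eq[of 0] by (simp add: even_words_def weight_def translation_def permute_word_def vec_eq_iff)
    then have a: "a = u" by (simp add: \<phi>_def)
    fix k :: 'n
    have "\<exists>S. {k, \<pi> k} \<subseteq> S \<and> card S = 2"
    proof (cases "\<pi> k = k")
      case True
      have "\<exists>j. j \<noteq> k"
      proof (rule ccontr)
        assume "\<not> (\<exists>j. j \<noteq> k)"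
        then have "(UNIV :: 'n set) = {k}" by auto
        then have "CARD('n) = 1" by (metis card.empty card_insert_if finite.emptyI empty_iff One_nat_def)
        with n4 show False by simp
      qed
      then obtain j where "j \<noteq> k" by blast
      with True show ?thesis by (intro exI[of _ "{j, k}"]) auto
    next
      case False
      then show ?thesis by (intro exI[of _ "{k, \<pi> k}"]) auto
    qed
    then obtain S where S: "k \<in> S" "\<pi> k \<in> S" "card S = 2" by auto
    define e :: "bit ^ 'n" where "e = (\<chi> i. if i \<in> S then 1 else 0)"
    have w: "weight e = 2" using S by (simp add: weight_def e_def)
    have "e \<noteq> 0" using w by (auto simp: weight_def)
    moreover have "e \<noteq> u" using w n4 by (auto simp: weight_def u_def)
    ultimately have "e = permute_word \<pi> e + u"
      using eq[of e] w a by (simp add: even_words_def translation_def \<phi>_def)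
    then have "e $ k = e $ \<pi> k + 1" by (metis permute_word_def u_def vec_lambda_beta vector_add_component)
    then show False using S by (simp add: e_def)
  qed
  then show ?thesis using iso by blast
qed

end

theory Submission
  imports Defs
begin

text \<open>
  An even isometry \<open>\<phi>\<close> keeps the distance of any two words whose weights have the same parity.
  So \<open>E\<close> and \<open>O\<close>, the sets of words of even and of odd weight, can be treated separately:
  \<open>\<phi>\<close> preserves all distances within each of them, and the only link between the two is the parity of the images.

  Moving a base word \<open>c\<close> of the class and its image \<open>\<phi> c\<close> to \<open>0\<close> and passing to supports turns
  \<open>\<phi>\<close> into a map \<open>F\<close> on sets of even size with \<open>F {} = {}\<close> that preserves the size of symmetric
  differences, hence also sizes, sizes of intersections, and inclusions. On 2-element sets \<open>F\<close>
  is an automorphism of the line graph of the complete graph on \<open>n\<close> vertices, and for \<open>n \<noteq> 4\<close>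
  Whitney's theorem says that such an automorphism comes from a permutation of the vertices
  (\<open>pair_map_induced_by_bij\<close>). Every even set is the union of the pairs that it contains, so this
  permutation describes \<open>F\<close> completely (\<open>even_set_isometry_is_image\<close>). Going back to words gives
  a permutation and a translation on each class (\<open>even_isometry_on_coset\<close>, with \<open>c = 0\<close> for \<open>E\<close>
  and \<open>c\<close> of weight 1 for \<open>O\<close>). As \<open>\<phi>\<close> is onto, \<open>E\<close> and \<open>O\<close> have images of different
  parity, which forces the two translation words to have equal parity.

  Conversely, permutations and translations preserve all distances, so a map composed of two such
  pieces keeps every even distance; the parity condition makes the images of \<open>E\<close> and \<open>O\<close>
  disjoint, hence the map injective.
\<close>

section \<open>Maps on sets of even size that preserve symmetric differences\<close>

lemma card_sym_diff_Int:
  fixes A B :: "'a::finite set"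
  shows "card (sym_diff A B) + 2 * card (A \<inter> B) = card A + card B"
proof -
  have "card A = card (A - B) + card (A \<inter> B)"
    by (metis card_Diff_subset_Int card_mono finite Int_lower1 le_add_diff_inverse2)
  moreover have "card B = card (B - A) + card (A \<inter> B)"
    by (metis card_Diff_subset_Int card_mono finite Int_commute Int_lower1 le_add_diff_inverse2)
  moreover have "card (sym_diff A B) = card (A - B) + card (B - A)"
    by (rule card_Un_disjoint) auto
  ultimately show ?thesis by simp
qed

text \<open>
  Pairwise meeting 2-element sets form a star or a triangle. A triangle has only three members, so
  a fourth set \<open>D\<close> forces \<open>A\<close>, \<open>B\<close>, \<open>C\<close> into a star, whose centre is the common element of
  \<open>A\<close> and \<open>B\<close>.
\<close>

lemma common_element_of_meeting_pairs:
  assumes cards: "card A = 2" "card B = 2" "card C = 2" "card D = 2"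
    and distinct: "A \<noteq> B" "A \<noteq> D" "B \<noteq> D" "C \<noteq> D"
    and meet: "A \<inter> C \<noteq> {}" "B \<inter> C \<noteq> {}" "A \<inter> D \<noteq> {}" "B \<inter> D \<noteq> {}" "C \<inter> D \<noteq> {}"
    and p: "p \<in> A" "p \<in> B"
  shows "p \<in> C"
proof (rule ccontr)
  assume pC: "p \<notin> C"
  obtain q where A: "A = {p, q}" and "q \<noteq> p" using cards(1) p(1) by (auto simp: card_2_iff)
  obtain r where B: "B = {p, r}" and "r \<noteq> p" using cards(2) p(2) by (auto simp: card_2_iff)
  have "q \<noteq> r" using A B distinct by auto
  moreover have "q \<in> C" "r \<in> C" using A B meet pC by auto
  ultimately have C: "C = {q, r}" using cards(3) by (auto simp: card_2_iff)
  obtain s t where D: "D = {s, t}" "s \<noteq> t" using cards(4) by (auto simp: card_2_iff)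
  show False using meet(3-5) distinct(2-4) \<open>q \<noteq> r\<close> \<open>q \<noteq> p\<close> \<open>r \<noteq> p\<close> D(2)
    unfolding A B C D(1) by blast
qed

text \<open>
  A special case of Whitney's theorem on line graphs, with \<open>n = CARD('n)\<close>. For \<open>n \<ge> 5\<close> each vertex lies on at least
  four edges, so the image of its star is again a star, and \<open>\<pi>\<close> sends centres to centres. For
  \<open>n = 3\<close> a pair is the complement of a point, so \<open>\<pi>\<close> can be read off from complements. For
  \<open>n = 4\<close> the statement fails: taking complements of pairs turns stars into triangles.
\<close>

lemma pair_map_induced_by_bij:
  fixes F :: "'n::finite set \<Rightarrow> 'n set"
  assumes n4: "CARD('n) \<noteq> 4"
    and card_F: "\<And>A. card A = 2 \<Longrightarrow> card (F A) = 2"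
    and inter_F: "\<And>A B. card A = 2 \<Longrightarrow> card B = 2 \<Longrightarrow> card (F A \<inter> F B) = card (A \<inter> B)"
  shows "\<exists>\<pi>. bij \<pi> \<and> (\<forall>i j. i \<noteq> j \<longrightarrow> F {i, j} = {\<pi> i, \<pi> j})"
proof -
  have inj_F: "A = B" if "card A = 2" "card B = 2" "F A = F B" for A B
  proof -
    have "card (A \<inter> B) = 2" using inter_F[OF that(1,2)] card_F[OF that(2)] that(3) by simp
    then have "A \<inter> B = A" "A \<inter> B = B" using that(1,2) by (simp_all add: card_subset_eq)
    then show ?thesis by blast
  qed
  consider "CARD('n) \<le> 2" | "CARD('n) = 3" | "CARD('n) \<ge> 5" using n4 by linarith
  then show ?thesis
  proof cases
    case 1
    have "F {i, j} = {i, j}" if "i \<noteq> j" for i j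
    proof -
      have full: "A = UNIV" if "card A = 2" for A :: "'n set"
        using that 1 card_mono[of UNIV A] by (intro card_subset_eq) auto
      have "card {i, j} = 2" using that by simp
      then show ?thesis using full card_F by metis
    qed
    then show ?thesis by (intro exI[of _ id]) auto
  next
    case 2
    have card_Compl: "card (- A) = CARD('n) - card A" for A :: "'n set"
      by (simp add: Compl_eq_Diff_UNIV card_Diff_subset)
    have co: "card (- {k}) = 2" for k :: 'n using 2 by (simp add: card_Compl)
    have "\<exists>m. F (- {k}) = - {m}" for k
    proof -
      have "card (- F (- {k})) = 1" using 2 card_F[OF co[of k]] by (simp add: card_Compl)
      then show ?thesis by (metis card_1_singletonE double_complement)
    qed
    then obtain \<pi> where \<pi>: "\<And>k. F (- {k}) = - {\<pi> k}" by metis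
    have inj: "inj \<pi>"
    proof (rule injI)
      fix k l assume "\<pi> k = \<pi> l"
      then have "F (- {k}) = F (- {l})" using \<pi> by simp
      then have "- {k} = - {l}" by (rule inj_F[OF co co])
      then show "k = l" by auto
    qed
    then have bij: "bij \<pi>" by (simp add: finite_UNIV_inj_surj bij_def)
    have "F {i, j} = {\<pi> i, \<pi> j}" if ij: "i \<noteq> j" for i j
    proof -
      have "card (- {i, j}) = 1" using 2 ij by (simp add: card_Compl)
      then obtain k where k: "- {i, j} = {k}" by (rule card_1_singletonE)
      then have "{i, j} = - {k}" by blast
      moreover have "- {\<pi> k} = \<pi> ` (- {k})" using bij by (simp add: bij_image_Compl_eq)
      ultimately show ?thesis using \<pi>[of k] by (metis image_insert image_empty)
    qed
    then show ?thesis using bij by blast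
  next
    case 3
    have fresh: "\<exists>x. x \<notin> set xs" if "length xs \<le> 4" for xs :: "'n list"
    proof (rule ccontr)
      assume "\<nexists>x. x \<notin> set xs"
      then have "set xs = UNIV" by auto
      then show False using card_length[of xs] that 3 by simp
    qed
    \<comment> \<open>The centre of the star that is the image of the star at \<open>i\<close>.\<close>
    have "\<exists>p. \<forall>j. j \<noteq> i \<longrightarrow> p \<in> F {i, j}" for i
    proof -
      have star: "card (F {i, j} \<inter> F {i, k}) = 1" "card (F {i, j}) = 2"
        if "j \<noteq> i" "k \<noteq> i" "j \<noteq> k" for j k
      proof -
        have "{i, j} \<inter> {i, k} = {i}" using that by auto
        then show "card (F {i, j} \<inter> F {i, k}) = 1"
          using inter_F[of "{i, j}" "{i, k}"] that by simp
        show "card (F {i, j}) = 2" using card_F that by simp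
      qed
      have diff: "F {i, j} \<noteq> F {i, k}" "F {i, j} \<inter> F {i, k} \<noteq> {}"
        if "j \<noteq> i" "k \<noteq> i" "j \<noteq> k" for j k
        using star[OF that] by auto
      obtain j where j: "j \<noteq> i" using fresh[of "[i]"] by auto
      obtain k where k: "k \<noteq> i" "j \<noteq> k" using fresh[of "[i, j]"] by auto
      obtain p where p: "p \<in> F {i, j}" "p \<in> F {i, k}" using diff(2)[OF j k] by auto
      have "p \<in> F {i, l}" if l: "l \<noteq> i" for l
      proof (cases "l = j \<or> l = k")
        case False
        \<comment> \<open>A fifth point provides the fourth edge at \<open>i\<close>, which excludes the triangle.\<close>
        obtain m where "m \<noteq> i" "j \<noteq> m" "k \<noteq> m" "l \<noteq> m"
          using fresh[of "[i, j, k, l]"] by auto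
        moreover have "j \<noteq> l" "k \<noteq> l" using False by auto
        ultimately show ?thesis using j k l p
          by (intro common_element_of_meeting_pairs
              [of "F {i, j}" "F {i, k}" "F {i, l}" "F {i, m}"])
            (simp_all add: diff card_F)
      qed (use p in auto)
      then show ?thesis by blast
    qed
    then obtain \<pi> where \<pi>: "\<And>i j. j \<noteq> i \<Longrightarrow> \<pi> i \<in> F {i, j}" by metis
    have inj: "inj \<pi>"
    proof (rule injI, rule ccontr)
      \<comment> \<open>If two stars had images with the same centre, disjoint edges would have meeting images.\<close>
      fix i k assume eq: "\<pi> i = \<pi> k" and ik: "i \<noteq> k"
      obtain j where j: "j \<noteq> i" "j \<noteq> k" using fresh[of "[i, k]"] by auto
      obtain l where l: "l \<noteq> i" "l \<noteq> k" "l \<noteq> j" using fresh[of "[i, k, j]"] by auto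
      have "{i, j} \<inter> {k, l} = {}" using ik j l by auto
      then have "F {i, j} \<inter> F {k, l} = {}"
        using inter_F[of "{i, j}" "{k, l}"] j l by simp
      then show False using \<pi>[of j i] \<pi>[of l k] eq j l by auto
    qed
    have "F {i, j} = {\<pi> i, \<pi> j}" if ij: "i \<noteq> j" for i j
    proof -
      have "{\<pi> i, \<pi> j} \<subseteq> F {i, j}" using \<pi>[of j i] \<pi>[of i j] ij by (auto simp: insert_commute)
      moreover have "card (F {i, j}) = 2" using card_F ij by simp
      moreover have "card {\<pi> i, \<pi> j} = 2" using inj ij by (simp add: inj_eq)
      ultimately show ?thesis by (metis card_subset_eq finite)
    qed
    moreover have "bij \<pi>" using inj by (simp add: finite_UNIV_inj_surj bij_def)
    ultimately show ?thesis by blast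
  qed
qed

text \<open>
  The case \<open>B = {}\<close> of the hypothesis shows that \<open>F\<close> preserves size; then it preserves the size of
  intersections, hence inclusions. So \<open>F A\<close> contains the images \<open>{\<pi> i, \<pi> j}\<close> of the pairs in \<open>A\<close>,
  which cover \<open>\<pi> ` A\<close>, and counting gives equality.
\<close>

lemma even_set_isometry_is_image:
  fixes F :: "'n::finite set \<Rightarrow> 'n set"
  assumes n4: "CARD('n) \<noteq> 4"
    and F0: "F {} = {}"
    and iso: "\<And>A B. even (card A) \<Longrightarrow> even (card B) \<Longrightarrow>
      card (sym_diff (F A) (F B)) = card (sym_diff A B)"
  shows "\<exists>\<pi>. bij \<pi> \<and> (\<forall>A. even (card A) \<longrightarrow> F A = \<pi> ` A)"
proof -
  have card_F: "card (F A) = card A" if "even (card A)" for A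
    using iso[of A "{}"] that F0 by simp
  have inter_F: "card (F A \<inter> F B) = card (A \<inter> B)" if "even (card A)" "even (card B)" for A B
    using iso[OF that] card_F[OF that(1)] card_F[OF that(2)]
      card_sym_diff_Int[of "F A" "F B"] card_sym_diff_Int[of A B] by simp
  have mono_F: "F A \<subseteq> F B" if "even (card A)" "even (card B)" "A \<subseteq> B" for A B
  proof -
    have "card (F A \<inter> F B) = card (F A)"
      using inter_F[OF that(1,2)] card_F[OF that(1)] that(3) by (simp add: Int_absorb2)
    then have "F A \<inter> F B = F A" by (intro card_subset_eq) auto
    then show ?thesis by blast
  qed
  obtain \<pi> where bij: "bij \<pi>" and pairs: "\<And>i j. i \<noteq> j \<Longrightarrow> F {i, j} = {\<pi> i, \<pi> j}"
    using pair_map_induced_by_bij[OF n4, of F] card_F inter_F by auto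
  have "F A = \<pi> ` A" if A: "even (card A)" for A
  proof -
    have "\<pi> i \<in> F A" if i: "i \<in> A" for i
    proof -
      \<comment> \<open>A nonempty set of even size has a second element to pair \<open>i\<close> with.\<close>
      have "A \<noteq> {i}" using A by auto
      then obtain j where j: "j \<in> A" "j \<noteq> i" using i by blast
      then have "F {i, j} \<subseteq> F A" using A i by (intro mono_F) auto
      then show ?thesis using pairs[of i j] j by simp
    qed
    then have "\<pi> ` A \<subseteq> F A" by blast
    moreover have "card (\<pi> ` A) = card (F A)"
      using bij card_F[OF A] by (simp add: card_image bij_is_inj inj_on_subset[OF bij_is_inj])
    ultimately show ?thesis by (metis card_subset_eq finite)
  qed
  then show ?thesis using bij by blast
qed

section \<open>Words and their supports\<close>

definition support :: "bit ^ 'n::finite \<Rightarrow> 'n set" where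
  "support x = {i. x $ i \<noteq> 0}"

definition indicator_word :: "'n::finite set \<Rightarrow> bit ^ 'n" where
  "indicator_word A = (\<chi> i. if i \<in> A then 1 else 0)"

lemma support_indicator_word [simp]: "support (indicator_word A) = A"
  by (simp add: support_def indicator_word_def)

lemma indicator_word_support [simp]: "indicator_word (support x) = x"
  by (simp add: support_def indicator_word_def vec_eq_iff)

lemma indicator_word_empty [simp]: "indicator_word {} = 0"
  by (simp add: indicator_word_def vec_eq_iff)

lemma finite_words: "finite (UNIV :: (bit ^ 'n::finite) set)"
proof (rule finite_imageD)
  show "finite (range (support :: bit ^ 'n \<Rightarrow> 'n set))" by simp
  show "inj (support :: bit ^ 'n \<Rightarrow> 'n set)" by (metis injI indicator_word_support)
qed

lemma weight_card_support: "weight x = card (support x)"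
  by (simp add: weight_def support_def)

lemma support_add: "support (x + y) = sym_diff (support x) (support y)"
  by (auto simp: support_def)

lemma word_add_self [simp]: "x + x = 0" "x + (x + y) = y" for x :: "bit ^ 'n::finite"
  by (simp_all add: vec_eq_iff)

lemma word_add_add_cancel [simp]: "(x + c) + (y + c) = x + y" for x :: "bit ^ 'n::finite"
  by (metis add.assoc add.commute word_add_self(2))

lemma hamming_dist_weight_add: "hamming_dist x y = weight (x + y)"
  unfolding hamming_dist_def weight_def by (rule arg_cong[of _ _ card]) (auto simp: vec_eq_iff)

lemma even_weight_add: "even (weight (x + y)) \<longleftrightarrow> (even (weight x) \<longleftrightarrow> even (weight y))"
  using card_sym_diff_Int[of "support x" "support y"]
  unfolding weight_card_support support_add by presburger

lemma weight_0 [simp]: "weight 0 = 0"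
  by (simp add: weight_def)

lemma weight_eq_0: "weight x = 0 \<longleftrightarrow> x = 0"
  by (simp add: weight_def vec_eq_iff)

lemma permute_word_add: "permute_word \<pi> (x + y) = permute_word \<pi> x + permute_word \<pi> y"
  by (simp add: permute_word_def vec_eq_iff)

lemma support_permute_word: "support (permute_word \<pi> x) = \<pi> -` support x"
  by (auto simp: support_def permute_word_def)

lemma weight_permute_word:
  assumes "bij \<pi>"
  shows "weight (permute_word \<pi> x) = weight x"
  using assms unfolding weight_card_support support_permute_word
  by (intro card_vimage_inj) (auto simp: bij_def)

section \<open>Even isometries\<close>

lemma even_isometry_weight:
  fixes \<phi> :: "bit ^ 'n::finite \<Rightarrow> bit ^ 'n"
  assumes "even_isometry \<phi>" and "even (weight (x + y))"
  shows "weight (\<phi> x + \<phi> y) = weight (x + y)"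
proof (cases "weight (x + y) = 0")
  case True
  then have "x = y" by (metis weight_eq_0 word_add_self(2) add_0_right)
  then show ?thesis by simp
next
  case False
  have "weight (x + y) \<le> CARD('n)" unfolding weight_card_support by (rule card_mono) auto
  then show ?thesis using False assms unfolding even_isometry_def hamming_dist_weight_add by auto
qed

text \<open>
  The words \<open>x\<close> with \<open>x + c\<close> of even weight form \<open>E\<close> or \<open>O\<close>, according to the parity of \<open>c\<close>.
  The map \<open>y \<mapsto> \<phi> (y + c) + \<phi> c\<close> fixes \<open>0\<close> and preserves distances on \<open>E\<close>, so on supports it is
  the image map of a bijection. A permutation of coordinates acts on supports by preimages, hence
  the inverse in the proof.
\<close>

lemma even_isometry_on_coset:
  fixes \<phi> :: "bit ^ 'n::finite \<Rightarrow> bit ^ 'n"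
  assumes n4: "CARD('n) \<noteq> 4" and \<phi>: "even_isometry \<phi>"
  shows "\<exists>\<pi>. \<pi> permutes UNIV \<and>
    (\<forall>x. even (weight (x + c)) \<longrightarrow> \<phi> x = permute_word \<pi> x + (permute_word \<pi> c + \<phi> c))"
proof -
  define F where "F A = support (\<phi> (indicator_word A + c) + \<phi> c)" for A
  have sd: "sym_diff A B = support (indicator_word A + indicator_word B)" for A B :: "'n set"
    by (simp add: support_add)
  have "card (sym_diff (F A) (F B)) = card (sym_diff A B)"
    if "even (card A)" "even (card B)" for A B
  proof -
    have "sym_diff (F A) (F B) = support (\<phi> (indicator_word A + c) + \<phi> (indicator_word B + c))"
      unfolding F_def support_add[symmetric] by simp
    moreover have "even (weight ((indicator_word A + c) + (indicator_word B + c)))"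
      using that unfolding even_weight_add by (simp add: weight_card_support)
    ultimately show ?thesis
      using even_isometry_weight[OF \<phi>, of "indicator_word A + c" "indicator_word B + c"]
      by (simp add: weight_card_support sd)
  qed
  moreover have "F {} = {}" by (simp add: F_def support_def)
  ultimately obtain \<rho> where \<rho>: "bij \<rho>" "\<And>A. even (card A) \<Longrightarrow> F A = \<rho> ` A"
    using even_set_isometry_is_image[OF n4] by metis
  define \<pi> where "\<pi> = inv \<rho>"
  have perm: "\<pi> permutes UNIV"
    using \<rho>(1) unfolding \<pi>_def
    by (intro bij_imp_permutes bij_imp_bij_inv) auto
  have "\<phi> x = permute_word \<pi> x + (permute_word \<pi> c + \<phi> c)" if x: "even (weight (x + c))" for x
  proof -
    have "support (\<phi> x + \<phi> c) = F (support (x + c))"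
      by (simp add: F_def add.assoc)
    also have "\<dots> = \<pi> -` support (x + c)"
      using \<rho> x by (simp add: weight_card_support \<pi>_def bij_vimage_eq_inv_image bij_imp_bij_inv inv_inv_eq)
    finally have "support (\<phi> x + \<phi> c) = support (permute_word \<pi> (x + c))"
      by (simp add: support_permute_word)
    then have "\<phi> x + \<phi> c = permute_word \<pi> (x + c)" by (metis indicator_word_support)
    then show ?thesis
      by (metis add.assoc add.commute permute_word_add word_add_self(2))
  qed
  then show ?thesis using perm by blast
qed

lemma even_isometry_decomposition:
  fixes \<phi> :: "bit ^ 'n::finite \<Rightarrow> bit ^ 'n"
  assumes n4: "CARD('n) \<noteq> 4" and \<phi>: "even_isometry \<phi>"
  shows "\<exists>\<pi> \<sigma> a b. \<pi> permutes UNIV \<and> \<sigma> permutes UNIV \<and>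
          (a \<in> even_words \<and> b \<in> even_words \<or> a \<in> odd_words \<and> b \<in> odd_words) \<and>
          (\<forall>x\<in>even_words. \<phi> x = (translation a \<circ> permute_word \<pi>) x) \<and>
          (\<forall>x\<in>odd_words. \<phi> x = (translation b \<circ> permute_word \<sigma>) x)"
proof -
  obtain k :: 'n where True by simp
  define e where "e = indicator_word {k}"
  have e: "weight e = 1" by (simp add: e_def weight_card_support)
  obtain \<pi> where \<pi>: "\<pi> permutes UNIV"
      "\<And>x. even (weight x) \<Longrightarrow> \<phi> x = permute_word \<pi> x + (permute_word \<pi> 0 + \<phi> 0)"
    using even_isometry_on_coset[OF n4 \<phi>, of 0] by auto
  obtain \<sigma> where \<sigma>: "\<sigma> permutes UNIV"
      "\<And>x. odd (weight x) \<Longrightarrow> \<phi> x = permute_word \<sigma> x + (permute_word \<sigma> e + \<phi> e)"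
    using even_isometry_on_coset[OF n4 \<phi>, of e] e by (auto simp: even_weight_add)
  \<comment> \<open>The images of the words of one class have constant parity, that of the base word's image.\<close>
  have image: "even (weight (\<phi> x)) \<longleftrightarrow> even (weight (\<phi> (if even (weight x) then 0 else e)))" for x
  proof -
    define c where "c = (if even (weight x) then 0 else e)"
    have "even (weight (x + c))" using e by (simp add: c_def even_weight_add)
    then have "even (weight (\<phi> x + \<phi> c))" by (simp add: even_isometry_weight[OF \<phi>])
    then show ?thesis by (simp add: even_weight_add c_def)
  qed
  have surj: "surj \<phi>" using \<phi> by (simp add: even_isometry_def bij_is_surj)
  \<comment> \<open>Both parities occur among the images, so the two classes have images of different parity.\<close>
  obtain y z where "\<phi> y = 0" "\<phi> z = e" using surj by (metis surjD)
  then have parity: "even (weight (\<phi> e)) \<longleftrightarrow> odd (weight (\<phi> 0))"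
    using image[of y] image[of z] e by (auto split: if_splits)
  define a b where "a = permute_word \<pi> 0 + \<phi> 0" and "b = permute_word \<sigma> e + \<phi> e"
  have bij: "bij \<pi>" "bij \<sigma>" using \<pi>(1) \<sigma>(1) by (auto simp: permutes_bij)
  have "even (weight a) \<longleftrightarrow> even (weight b)"
    using parity e by (simp add: a_def b_def even_weight_add weight_permute_word bij)
  then have "a \<in> even_words \<and> b \<in> even_words \<or> a \<in> odd_words \<and> b \<in> odd_words"
    by (auto simp: even_words_def odd_words_def)
  moreover have "\<forall>x\<in>even_words. \<phi> x = (translation a \<circ> permute_word \<pi>) x"
    using \<pi>(2) unfolding even_words_def translation_def a_def o_def by blast
  moreover have "\<forall>x\<in>odd_words. \<phi> x = (translation b \<circ> permute_word \<sigma>) x"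
    using \<sigma>(2) unfolding odd_words_def translation_def b_def o_def by blast
  ultimately show ?thesis using \<pi>(1) \<sigma>(1) by blast
qed

lemma even_isometry_from_parts:
  fixes \<phi> :: "bit ^ 'n::finite \<Rightarrow> bit ^ 'n"
  assumes perm: "\<pi> permutes UNIV" "\<sigma> permutes UNIV"
    and ab: "a \<in> even_words \<and> b \<in> even_words \<or> a \<in> odd_words \<and> b \<in> odd_words"
    and E: "\<forall>x\<in>even_words. \<phi> x = (translation a \<circ> permute_word \<pi>) x"
    and O: "\<forall>x\<in>odd_words. \<phi> x = (translation b \<circ> permute_word \<sigma>) x"
  shows "even_isometry \<phi>"
proof -
  have bij: "bij \<pi>" "bij \<sigma>" using perm by (auto simp: permutes_bij)
  have E': "\<phi> x = permute_word \<pi> x + a" if "even (weight x)" for x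
    using E that by (simp add: even_words_def translation_def)
  have O': "\<phi> x = permute_word \<sigma> x + b" if "odd (weight x)" for x
    using O that by (simp add: odd_words_def translation_def)
  have dist: "weight (\<phi> x + \<phi> y) = weight (x + y)" if xy: "even (weight (x + y))" for x y
  proof (cases "even (weight x)")
    case True
    then have "even (weight y)" using xy by (simp add: even_weight_add)
    then show ?thesis using True
      by (simp add: E' weight_permute_word bij flip: permute_word_add)
  next
    case False
    then have "odd (weight y)" using xy by (simp add: even_weight_add)
    then show ?thesis using False
      by (simp add: O' weight_permute_word bij flip: permute_word_add)
  qed
  have parity: "even (weight (\<phi> x)) \<longleftrightarrow> (even (weight x) \<longleftrightarrow> even (weight a))" for x
    using ab by (cases "even (weight x)")
      (auto simp: E' O' even_weight_add weight_permute_word bij even_words_def odd_words_def)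
  have "inj \<phi>"
  proof (rule injI)
    fix x y assume eq: "\<phi> x = \<phi> y"
    then have "even (weight (x + y))" using parity[of x] parity[of y] by (auto simp: even_weight_add)
    then have "weight (x + y) = 0" using dist[of x y] eq by simp
    then show "x = y" by (metis weight_eq_0 word_add_self(2) add_0_right)
  qed
  then have "bij \<phi>" by (simp add: bij_def finite_UNIV_inj_surj[OF finite_words])
  then show ?thesis using dist by (auto simp: even_isometry_def hamming_dist_weight_add)
qed

theorem theorem3:
  shows "(CARD('n::finite) \<noteq> 4 \<longrightarrow>
      (\<forall>\<phi> :: bit ^ 'n \<Rightarrow> bit ^ 'n. even_isometry \<phi> \<longrightarrow>
        (\<exists>\<pi> \<sigma> a b. \<pi> permutes UNIV \<and> \<sigma> permutes UNIV \<and>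
          (a \<in> even_words \<and> b \<in> even_words \<or> a \<in> odd_words \<and> b \<in> odd_words) \<and>
          (\<forall>x\<in>even_words. \<phi> x = (translation a \<circ> permute_word \<pi>) x) \<and>
          (\<forall>x\<in>odd_words. \<phi> x = (translation b \<circ> permute_word \<sigma>) x)))) \<and>
    (\<forall>(\<pi> :: 'n \<Rightarrow> 'n) \<sigma> a b. \<forall>\<phi> :: bit ^ 'n \<Rightarrow> bit ^ 'n.
      \<pi> permutes UNIV \<and> \<sigma> permutes UNIV \<and>
      (a \<in> even_words \<and> b \<in> even_words \<or> a \<in> odd_words \<and> b \<in> odd_words) \<and>
      (\<forall>x\<in>even_words. \<phi> x = (translation a \<circ> permute_word \<pi>) x) \<and>
      (\<forall>x\<in>odd_words. \<phi> x = (translation b \<circ> permute_word \<sigma>) x) \<longrightarrow>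
      even_isometry \<phi>)"
  using even_isometry_decomposition even_isometry_from_parts by blast

end
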